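(* Let $G$ be a simple graph with vertex set $V=\{v_1,\dots,v_n\}$ and maximum degree $\Delta$. Let $G^\sigma$ be an oriented graph of $G$ with $\rho_s(G^\sigma)=\sqrt{\Delta}$ and skew adjacency matrix $S=(S_1,S_2,\dots,S_n)$, where $S_k$ denotes the $k$-th column of $S$. If $d_G(v_i)=\Delta$, then $S_i^TS_j=0$ for every $j\neq i$.
   Context: An oriented graph $G^\sigma$ of a simple graph $G$ on vertices $v_1,\dots,v_n$ is obtained by giving each edge of $G$ one of its two directions. Its skew adjacency matrix $S=(s_{ij})$ has $s_{ij}=1$, $s_{ji}=-1$ if $\langle v_i,v_j\rangle$ is an arc, and $s_{ij}=s_{ji}=0$ otherwise. The skew spectral radius $\rho_s(G^\sigma)$ is the spectral radius of $S$. $d_G(v)$ denotes the degree of $v$ in $G$. *)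

theory Defs
  imports "Graph_Theory.Pair_Digraph" "Jordan_Normal_Form.Spectral_Radius"
begin

text \<open>
  A finite simple graph is a \<open>pair_graph\<close>: a finite, loop-free and symmetric set of vertex pairs,
  where an undirected edge \<open>uv\<close> is represented by both \<open>(u, v)\<close> and \<open>(v, u)\<close>. Hence the number
  of edges at \<open>x\<close> is the out-degree of \<open>x\<close>, not the sum of in- and out-degree.
\<close>

definition graph_degree :: "'a pair_pre_digraph \<Rightarrow> 'a \<Rightarrow> nat" where
  "graph_degree G x = out_degree (with_proj G) x"

definition max_degree :: "'a pair_pre_digraph \<Rightarrow> nat" where
  "max_degree G = Max (graph_degree G ` pverts G)"

definition oriented_graph_of :: "'a pair_pre_digraph \<Rightarrow> 'a pair_pre_digraph \<Rightarrow> bool" where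
  "oriented_graph_of D G \<longleftrightarrow>
     pverts D = pverts G \<and> parcs D \<subseteq> parcs G \<and>
     (\<forall>(u, w) \<in> parcs G. ((u, w) \<in> parcs D) \<noteq> ((w, u) \<in> parcs D))"

text \<open>
  The vertices are numbered \<open>v 0, \<dots>, v (n - 1)\<close>, since matrix indices start from 0.
\<close>

definition skew_adjacency_matrix :: "nat \<Rightarrow> (nat \<Rightarrow> 'a) \<Rightarrow> 'a pair_pre_digraph \<Rightarrow> real mat" where
  "skew_adjacency_matrix n v D = mat n n (\<lambda>(i, j).
     if (v i, v j) \<in> parcs D then 1
     else if (v j, v i) \<in> parcs D then - 1
     else 0)"

text \<open>The eigenvalues are complex (in fact purely imaginary), so the matrix is read over the
  complex numbers.\<close>

definition skew_spectral_radius :: "nat \<Rightarrow> (nat \<Rightarrow> 'a) \<Rightarrow> 'a pair_pre_digraph \<Rightarrow> real" where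
  "skew_spectral_radius n v D =
     spectral_radius (map_mat complex_of_real (skew_adjacency_matrix n v D))"

end

theory Submission
  imports Defs
begin

text \<open>
  Since \<open>S\<close> is skew-symmetric, \<open>S\<^sup>2 = - S\<^sup>T S\<close> has the entries \<open>- S\<^sub>k \<bullet> S\<^sub>l\<close> and
  the diagonal entries of \<open>S\<^sup>4\<close> are \<open>\<Sum>\<^sub>k (S\<^sub>i \<bullet> S\<^sub>k)\<^sup>2\<close>. A diagonal entry of the symmetric
  matrix \<open>S\<^sup>4\<close> is at most \<open>\<rho>\<^sup>4 = \<Delta>\<^sup>2\<close>. For a vertex of degree \<open>\<Delta>\<close> the summand
  \<open>(S\<^sub>i \<bullet> S\<^sub>i)\<^sup>2 = \<Delta>\<^sup>2\<close> already exhausts this bound, so all the others vanish.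
  The bound on the diagonal is obtained by repeated squaring: \<open>(T\<^sup>2)\<^sub>i\<^sub>i \<ge> (T\<^sub>i\<^sub>i)\<^sup>2\<close> for symmetric
  \<open>T\<close>, whereas the entries of \<open>S\<^sup>k\<close> grow at most like \<open>r\<^sup>k\<close> for every \<open>r > \<rho>\<close>.
\<close>

lemma pow_mat_smult:
  fixes A :: "'a :: comm_semiring_1 mat"
  assumes A: "A \<in> carrier_mat n n"
  shows "(c \<cdot>\<^sub>m A) ^\<^sub>m k = c ^ k \<cdot>\<^sub>m (A ^\<^sub>m k)"
proof (induction k)
  case 0
  show ?case using A by (intro eq_matI) auto
next
  case (Suc k)
  have "(c ^ k \<cdot>\<^sub>m (A ^\<^sub>m k)) * (c \<cdot>\<^sub>m A) = c ^ Suc k \<cdot>\<^sub>m (A ^\<^sub>m k * A)"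
    using A by (intro eq_matI) (auto simp: ac_simps)
  then show ?case by (simp add: Suc.IH)
qed

lemma transpose_pow_mat:
  fixes A :: "'a :: comm_semiring_1 mat"
  assumes A: "A \<in> carrier_mat n n" and sym: "transpose_mat A = A"
  shows "transpose_mat (A ^\<^sub>m k) = A ^\<^sub>m k"
proof (induction k)
  case (Suc k)
  have P: "A ^\<^sub>m k \<in> carrier_mat n n" using A by simp
  \<comment> \<open>Transposition reverses the order of the factors, while powers are built by
    multiplying on the right; commutation restores that order.\<close>
  have comm: "A * A ^\<^sub>m k = A ^\<^sub>m k * A"
  proof (induction k)
    case (Suc k)
    have "A * (A ^\<^sub>m k * A) = (A * A ^\<^sub>m k) * A"
      using A by (simp add: assoc_mult_mat[of _ n n _ n _ n])
    then show ?case by (simp add: Suc.IH)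
  qed (use A in simp)
  show ?case by (simp add: transpose_mult[OF P A] sym Suc.IH comm)
qed simp

lemma pow_mat_pow:
  fixes A :: "'a :: semiring_1 mat"
  assumes A: "A \<in> carrier_mat n n"
  shows "(A ^\<^sub>m k) ^\<^sub>m l = A ^\<^sub>m (k * l)"
proof -
  interpret ring: semiring "ring_mat TYPE('a) n ()" by (rule semiring_mat)
  show ?thesis
    using ring.nat_pow_pow[of A k l] A pow_carrier_mat[OF A, of k]
    by (simp add: pow_mat_ring_pow[where n = n and b = "()"] ring_mat_simps)
qed

lemma spectral_radius_nonneg:
  assumes A: "A \<in> carrier_mat n n" and n: "0 < n"
  shows "0 \<le> spectral_radius A"
  using spectral_radius_mem_max(1)[OF A n] by auto

text \<open>Scaling by \<open>1 / r\<close> brings the spectral radius below 1, where the Jordan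
  normal form bounds all powers by one constant. At \<open>r\<close> equal to the spectral radius,
  Jordan blocks could add polynomial growth.\<close>

lemma spectral_radius_less_power_bound:
  assumes A: "A \<in> carrier_mat n n" and n: "0 < n" and r: "spectral_radius A < r"
  obtains C where "\<And>k. norm_bound (A ^\<^sub>m k) (C * r ^ k)"
proof -
  have r0: "0 < r" using spectral_radius_nonneg[OF A n] r by simp
  define B where "B = complex_of_real (1 / r) \<cdot>\<^sub>m A"
  have B: "B \<in> carrier_mat n n" using A by (simp add: B_def)
  \<comment> \<open>An eigenvalue of \<open>B\<close> of largest modulus: \<open>r * e\<close> is an
    eigenvalue of \<open>A\<close>, which forces \<open>norm e < 1\<close>.\<close>
  obtain e w where e: "spectral_radius B = norm e" and w: "eigenvector B w e"
    using spectral_radius_mem_max(1)[OF B n] by (auto simp: spectrum_def eigenvalue_def)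
  have wn: "w \<in> carrier_vec n" and w0: "w \<noteq> 0\<^sub>v n" and ev: "B *\<^sub>v w = e \<cdot>\<^sub>v w"
    using w B by (auto simp: eigenvector_def)
  have "A *\<^sub>v w = complex_of_real r \<cdot>\<^sub>v (B *\<^sub>v w)"
    using r0 A wn by (intro eq_vecI) (auto simp: B_def)
  also have "\<dots> = (of_real r * e) \<cdot>\<^sub>v w"
    by (simp add: ev smult_smult_assoc)
  finally have "eigenvalue A (of_real r * e)"
    using A wn w0 by (auto simp: eigenvalue_def eigenvector_def)
  then have "norm (of_real r * e) \<le> spectral_radius A"
    by (intro spectral_radius_mem_max(2)[OF A n]) (simp add: spectrum_def)
  then have "r * norm e \<le> spectral_radius A" using r0 by (simp add: norm_mult)
  then have "r * norm e < r" using r by (rule le_less_trans)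
  then have "spectral_radius B < 1" using e r0 by simp
  then obtain C where C: "\<And>k. norm_bound (B ^\<^sub>m k) C"
    using spectral_radius_jnf_norm_bound_less_1_upper_triangular[OF B] by blast
  have "norm_bound (A ^\<^sub>m k) (C * r ^ k)" for k
  proof
    fix a b assume "a < dim_row (A ^\<^sub>m k)" "b < dim_col (A ^\<^sub>m k)"
    then have ab: "a < n" "b < n"
      using pow_carrier_mat[OF A, of k] by auto
    have "norm ((B ^\<^sub>m k) $$ (a, b)) \<le> C"
      using C[of k] ab carrier_matD[OF pow_carrier_mat[OF B, of k]]
      by (simp only: norm_bound_def)
    moreover have "(B ^\<^sub>m k) $$ (a, b) = of_real (1 / r) ^ k * (A ^\<^sub>m k) $$ (a, b)"
      using ab carrier_matD[OF pow_carrier_mat[OF A, of k]]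
      by (simp only: B_def pow_mat_smult[OF A] index_smult_mat of_real_power)
    ultimately show "norm ((A ^\<^sub>m k) $$ (a, b)) \<le> C * r ^ k"
      using r0 by (simp add: norm_mult norm_power norm_divide power_divide field_simps)
  qed
  then show thesis by (rule that)
qed

text \<open>By symmetry the right-hand side is the sum of the squares of row \<open>i\<close>, and
  the left-hand side is one of its terms.\<close>

lemma diag_square_le:
  fixes T :: "real mat"
  assumes T: "T \<in> carrier_mat n n" and sym: "transpose_mat T = T" and i: "i < n"
  shows "(T $$ (i, i))\<^sup>2 \<le> (T * T) $$ (i, i)"
proof -
  have "T $$ (k, i) = T $$ (i, k)" if "k < n" for k
    using arg_cong[OF sym, of "\<lambda>M. M $$ (i, k)"] T i that by simp
  then have "(T * T) $$ (i, i) = (\<Sum>k = 0..<n. (T $$ (i, k))\<^sup>2)"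
    using T i by (auto simp: scalar_prod_def power2_eq_square intro!: sum.cong)
  then show ?thesis
    using i by (auto intro!: member_le_sum[of i])
qed

text \<open>Iterates the squaring inequality. The diagonal entry of \<open>T\<close> may be
  negative; absolute values allow the induction hypothesis to be squared.\<close>

lemma diag_power_two_power_le:
  fixes T :: "real mat"
  assumes T: "T \<in> carrier_mat n n" and sym: "transpose_mat T = T" and i: "i < n"
  shows "\<bar>T $$ (i, i)\<bar> ^ (2 ^ m) \<le> \<bar>(T ^\<^sub>m (2 ^ m)) $$ (i, i)\<bar>"
proof (induction m)
  case 0
  show ?case using T by simp
next
  case (Suc m)
  let ?P = "T ^\<^sub>m (2 ^ m)"
  have P: "?P \<in> carrier_mat n n" using T by simp
  have "\<bar>T $$ (i, i)\<bar> ^ (2 ^ Suc m) = (\<bar>T $$ (i, i)\<bar> ^ (2 ^ m))\<^sup>2"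
    by (simp add: power_mult[symmetric] mult.commute del: power_abs power_even_abs)
  also have "\<dots> \<le> \<bar>?P $$ (i, i)\<bar>\<^sup>2"
    by (intro power_mono Suc.IH) simp
  also have "\<dots> \<le> (?P * ?P) $$ (i, i)"
    using diag_square_le[OF P transpose_pow_mat[OF T sym] i] by simp
  also have "?P * ?P = T ^\<^sub>m (2 ^ Suc m)"
    using pow_mat_pow[OF T, of "2 ^ m" 2] P by (simp add: numeral_2_eq_2 mult.commute)
  finally show ?case by simp
qed

text \<open>A larger entry would make the powers of \<open>A\<close> grow faster than the spectral
  radius permits. Symmetry is required of the power only, so that a skew-symmetric \<open>A\<close>
  with \<open>p = 4\<close> is covered.\<close>

lemma diag_symmetric_power_le_spectral_radius:
  fixes A :: "real mat"
  assumes A: "A \<in> carrier_mat n n" and i: "i < n" and p: "0 < p"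
    and sym: "transpose_mat (A ^\<^sub>m p) = A ^\<^sub>m p"
  shows "\<bar>(A ^\<^sub>m p) $$ (i, i)\<bar> \<le> spectral_radius (map_mat complex_of_real A) ^ p"
proof (rule ccontr)
  let ?A = "map_mat complex_of_real A"
  let ?t = "\<bar>(A ^\<^sub>m p) $$ (i, i)\<bar>"
  have cA: "?A \<in> carrier_mat n n" using A by simp
  have n: "0 < n" using i by simp
  have \<rho>: "0 \<le> spectral_radius ?A" by (rule spectral_radius_nonneg[OF cA n])
  assume "\<not> ?thesis"
  then have "spectral_radius ?A ^ p < ?t" by simp
  then obtain q where q: "spectral_radius ?A ^ p < q" "q < ?t"
    by (blast dest: dense)
  have q0: "0 < q" using q(1) \<rho> by (meson le_less_trans zero_le_power)
  \<comment> \<open>The growth rate \<open>root p q\<close> is chosen so that its power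
    \<open>p * 2 ^ m\<close> is exactly \<open>q ^ (2 ^ m)\<close>.\<close>
  have "spectral_radius ?A < root p q"
    using real_root_less_mono[OF p q(1)] real_root_power_cancel[OF p \<rho>] by simp
  from spectral_radius_less_power_bound[OF cA n this]
  obtain C where C: "\<And>k. norm_bound (?A ^\<^sub>m k) (C * root p q ^ k)" by blast
  have bound: "(?t / q) ^ (2 ^ m) \<le> C" for m
  proof -
    let ?k = "p * 2 ^ m"
    have Ap: "A ^\<^sub>m p \<in> carrier_mat n n" using A by simp
    have "?t ^ (2 ^ m) \<le> \<bar>(A ^\<^sub>m ?k) $$ (i, i)\<bar>"
      using diag_power_two_power_le[OF Ap sym i] pow_mat_pow[OF A] by simp
    also have "\<dots> = norm ((?A ^\<^sub>m ?k) $$ (i, i))"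
      using A i by (simp add: of_real_hom.mat_hom_pow[OF A, symmetric])
    also have "\<dots> \<le> C * root p q ^ ?k"
      using C[of ?k] A i by (simp add: norm_bound_def)
    also have "root p q ^ ?k = q ^ (2 ^ m)"
      using q0 p by (simp add: power_mult)
    finally show ?thesis using q0 by (simp add: power_divide field_simps)
  qed
  have one: "1 < ?t / q" using q q0 by simp
  \<comment> \<open>The Archimedean property gives some exponent \<open>m\<close>; as the base
    exceeds 1 and \<open>m \<le> 2 ^ m\<close>, the bound for exponent \<open>2 ^ m\<close> is
    violated too.\<close>
  then obtain m where "C < (?t / q) ^ m" using real_arch_pow by blast
  also have "\<dots> \<le> (?t / q) ^ (2 ^ m)"
    using one by (intro power_increasing) (auto intro: less_imp_le)
  finally show False using bound[of m] by simp
qed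

text \<open>The left-hand side keeps only the terms \<open>k = i\<close> and \<open>k = j\<close> of
  the sum of squares that forms a diagonal entry of \<open>S ^\<^sub>m 4\<close>.\<close>

lemma skew_symmetric_cols_bound:
  fixes S :: "real mat"
  assumes S: "S \<in> carrier_mat n n" and skew: "transpose_mat S = - S"
    and i: "i < n" and j: "j < n" "j \<noteq> i"
  shows "(col S i \<bullet> col S i)\<^sup>2 + (col S i \<bullet> col S j)\<^sup>2
    \<le> spectral_radius (map_mat complex_of_real S) ^ 4"
proof -
  let ?A = "S * S"
  have A: "?A \<in> carrier_mat n n" using S by simp
  have sk: "S $$ (k, l) = - S $$ (l, k)" if "k < n" "l < n" for k l
    using arg_cong[OF skew, of "\<lambda>M. M $$ (l, k)"] S that by simp
  have entry: "?A $$ (k, l) = - (col S k \<bullet> col S l)" if "k < n" "l < n" for k l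
  proof -
    have "?A $$ (k, l) = (\<Sum>h = 0..<n. S $$ (k, h) * S $$ (h, l))"
      using S that by (simp add: scalar_prod_def)
    also have "\<dots> = (\<Sum>h = 0..<n. - (S $$ (h, k) * S $$ (h, l)))"
      using sk[OF that(1)] by (intro sum.cong) simp_all
    also have "\<dots> = - (col S k \<bullet> col S l)"
      using S that by (simp add: scalar_prod_def sum_negf)
    finally show ?thesis .
  qed
  have symA: "transpose_mat ?A = ?A"
    using S by (simp add: transpose_mult[OF S S] skew)
  have pow: "S ^\<^sub>m 4 = ?A * ?A"
    using S by (simp add: numeral_eq_Suc assoc_mult_mat[of _ n n _ n _ n])
  have sym: "transpose_mat (S ^\<^sub>m 4) = S ^\<^sub>m 4"
    by (simp add: pow transpose_mult[OF A A] symA)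
  have "(S ^\<^sub>m 4) $$ (i, i) = (\<Sum>k = 0..<n. ?A $$ (i, k) * ?A $$ (k, i))"
    using A i S by (simp add: pow scalar_prod_def)
  also have "\<dots> = (\<Sum>k = 0..<n. (col S i \<bullet> col S k)\<^sup>2)"
  proof (intro sum.cong refl)
    fix k assume "k \<in> {0..<n}"
    then show "?A $$ (i, k) * ?A $$ (k, i) = (col S i \<bullet> col S k)\<^sup>2"
      using S i entry[of i k] entry[of k i] comm_scalar_prod[of "col S k" n "col S i"]
      by (simp add: power2_eq_square del: index_mult_mat)
  qed
  finally have sum: "(S ^\<^sub>m 4) $$ (i, i) = (\<Sum>k = 0..<n. (col S i \<bullet> col S k)\<^sup>2)" .
  have "(col S i \<bullet> col S i)\<^sup>2 + (col S i \<bullet> col S j)\<^sup>2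
      = (\<Sum>k \<in> {i, j}. (col S i \<bullet> col S k)\<^sup>2)"
    using j by simp
  also have "\<dots> \<le> (S ^\<^sub>m 4) $$ (i, i)"
    unfolding sum using i j by (intro sum_mono2) auto
  also have "\<dots> \<le> spectral_radius (map_mat complex_of_real S) ^ 4"
    using diag_symmetric_power_le_spectral_radius[OF S i _ sym] by simp
  finally show ?thesis .
qed

lemma transpose_skew_adjacency_matrix:
  assumes "oriented_graph_of D G"
  shows "transpose_mat (skew_adjacency_matrix n v D) = - skew_adjacency_matrix n v D"
proof -
  \<comment> \<open>The case \<open>a = b\<close> excludes loops, so the diagonal of the matrix is
    zero.\<close>
  have "\<not> ((a, b) \<in> parcs D \<and> (b, a) \<in> parcs D)" for a b
    using assms by (fastforce simp: oriented_graph_of_def)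
  then show ?thesis
    by (intro eq_matI) (auto simp: skew_adjacency_matrix_def)
qed

text \<open>The entries are 0, 1 and -1, so their squares count the neighbours of
  \<open>v i\<close>, whatever the orientation.\<close>

lemma col_skew_adjacency_matrix_norm:
  assumes G: "pair_graph G" and v: "bij_betw v {..<n} (pverts G)"
    and D: "oriented_graph_of D G" and i: "i < n"
  shows "col (skew_adjacency_matrix n v D) i \<bullet> col (skew_adjacency_matrix n v D) i
    = real (graph_degree G (v i))"
proof -
  interpret pair_graph G by (rule G)
  have symG: "(b, a) \<in> parcs G" if "(a, b) \<in> parcs G" for a b
    using pair_sym_arcs that by (auto simp: symmetric_def sym_def)
  have arcs: "(a, b) \<in> parcs G \<longleftrightarrow> (a, b) \<in> parcs D \<or> (b, a) \<in> parcs D" for a b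
    using D symG by (fastforce simp: oriented_graph_of_def)
  let ?N = "{l \<in> {0..<n}. (v i, v l) \<in> parcs G}"
  have "col (skew_adjacency_matrix n v D) i \<bullet> col (skew_adjacency_matrix n v D) i
      = (\<Sum>l = 0..<n. if (v i, v l) \<in> parcs G then 1 else 0)"
    using i by (auto simp: scalar_prod_def skew_adjacency_matrix_def arcs intro!: sum.cong)
  also have "\<dots> = real (card ?N)"
    by (simp add: sum.If_cases Int_def)
  also have "card ?N = card ((\<lambda>l. (v i, v l)) ` ?N)"
    using v by (intro card_image[symmetric]) (auto simp: inj_on_def bij_betw_def)
  also have "(\<lambda>l. (v i, v l)) ` ?N = out_arcs (with_proj G) (v i)"
  \<comment> \<open>Surjectivity of \<open>v\<close> ensures that every neighbour has an index below
    \<open>n\<close>; injectivity was used to count each one once.\<close>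
  proof -
    have "b \<in> v ` {..<n}" if "(v i, b) \<in> parcs G" for b
      using arc_snd_in_verts[OF that] v by (simp add: bij_betw_def)
    then show ?thesis by (fastforce simp: out_arcs_def)
  qed
  finally show ?thesis by (simp add: graph_degree_def out_degree_def)
qed

theorem theorem3p3:
  fixes G D :: "'a pair_pre_digraph" and v :: "nat \<Rightarrow> 'a" and n i j :: nat
    and S :: "real mat"
  assumes "pair_graph G"
    and "bij_betw v {..<n} (pverts G)"
    and "oriented_graph_of D G"
    and "skew_spectral_radius n v D = sqrt (real (max_degree G))"
    and "S = skew_adjacency_matrix n v D"
    and "i < n"
    and "graph_degree G (v i) = max_degree G"
    and "j < n"
    and "j \<noteq> i"
  shows "scalar_prod (col S i) (col S j) = 0"
proof -
  let ?\<Delta> = "real (max_degree G)"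
  have S: "S \<in> carrier_mat n n" by (simp add: assms(5) skew_adjacency_matrix_def)
  have skew: "transpose_mat S = - S"
    unfolding assms(5) by (rule transpose_skew_adjacency_matrix[OF assms(3)])
  have "spectral_radius (map_mat complex_of_real S) ^ 4 = (sqrt ?\<Delta> ^ 2) ^ 2"
    unfolding assms(4)[unfolded skew_spectral_radius_def assms(5)[symmetric]]
    by (simp only: power_mult[symmetric]) simp
  also have "\<dots> = ?\<Delta>\<^sup>2" by simp
  finally have "(col S i \<bullet> col S i)\<^sup>2 + (col S i \<bullet> col S j)\<^sup>2 \<le> ?\<Delta>\<^sup>2"
    using skew_symmetric_cols_bound[OF S skew assms(6,8,9)] by simp
  moreover have "col S i \<bullet> col S i = ?\<Delta>"
    using col_skew_adjacency_matrix_norm[OF assms(1-3,6)] assms(5,7) by simp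
  \<comment> \<open>Cancelling \<open>?\<Delta>\<^sup>2\<close> leaves a square that is at most
    0.\<close>
  ultimately show ?thesis by simp
qed

end
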